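(* There exists a bounded sequence $\beta=(\beta_n)_{n\ge0}$ of positive numbers which has a polynomial minoration and is not essentially decreasing, such that every symbol $\phi$ with $\phi(0)=0$ induces a bounded composition operator $C_\phi$ on $H^2(\beta)$.
   Context: $H^2(\beta)$ is the Hilbert space of analytic functions $f(z)=\sum_{n\ge0}a_nz^n$ on the unit disk $\mathbb D$ with $\|f\|^2=\sum_{n\ge0}|a_n|^2\beta_n<\infty$. A symbol is a non-constant analytic map $\phi:\mathbb D\to\mathbb D$ and $C_\phi f=f\circ\phi$. $\beta$ is essentially decreasing if there is $C\ge1$ with $\beta_m\le C\beta_n$ for all $m\ge n\ge0$. $\beta$ has a polynomial minoration if there are constants $\delta,\alpha>0$ with $\beta_n\ge\delta n^{-\alpha}$ for all $n\ge1$. *)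

theory Defs
  imports "HOL-Complex_Analysis.Complex_Analysis"
begin

definition taylor_coeff :: "(complex \<Rightarrow> complex) \<Rightarrow> nat \<Rightarrow> complex" where
  "taylor_coeff f n = (deriv ^^ n) f 0 / of_nat (fact n)"

definition in_H2 :: "(nat \<Rightarrow> real) \<Rightarrow> (complex \<Rightarrow> complex) \<Rightarrow> bool" where
  "in_H2 \<beta> f \<longleftrightarrow> f holomorphic_on ball 0 1 \<and>
     summable (\<lambda>n. (norm (taylor_coeff f n))\<^sup>2 * \<beta> n)"

definition H2_norm :: "(nat \<Rightarrow> real) \<Rightarrow> (complex \<Rightarrow> complex) \<Rightarrow> real" where
  "H2_norm \<beta> f = sqrt (\<Sum>n. (norm (taylor_coeff f n))\<^sup>2 * \<beta> n)"

definition symbol :: "(complex \<Rightarrow> complex) \<Rightarrow> bool" where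
  "symbol \<phi> \<longleftrightarrow> \<phi> holomorphic_on ball 0 1 \<and> \<phi> ` ball 0 1 \<subseteq> ball 0 1 \<and>
     \<not> (\<exists>c. \<forall>z\<in>ball 0 1. \<phi> z = c)"

definition bounded_composition :: "(nat \<Rightarrow> real) \<Rightarrow> (complex \<Rightarrow> complex) \<Rightarrow> bool" where
  "bounded_composition \<beta> \<phi> \<longleftrightarrow>
     (\<exists>C. \<forall>f. in_H2 \<beta> f \<longrightarrow> in_H2 \<beta> (f \<circ> \<phi>) \<and> H2_norm \<beta> (f \<circ> \<phi>) \<le> C * H2_norm \<beta> f)"

definition essentially_decreasing :: "(nat \<Rightarrow> real) \<Rightarrow> bool" where
  "essentially_decreasing \<beta> \<longleftrightarrow> (\<exists>C\<ge>1. \<forall>m n. n \<le> m \<longrightarrow> \<beta> m \<le> C * \<beta> n)"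

definition polynomial_minoration :: "(nat \<Rightarrow> real) \<Rightarrow> bool" where
  "polynomial_minoration \<beta> \<longleftrightarrow>
     (\<exists>\<delta> \<alpha>. \<delta> > 0 \<and> \<alpha> > 0 \<and> (\<forall>n\<ge>1. \<beta> n \<ge> \<delta> * real n powr (-\<alpha>)))"

end

theory Submission
  imports Defs "HOL-Real_Asymp.Real_Asymp"
begin

text \<open>
  The weight is \<open>1/k!\<close> on the block \<open>k! \<le> n + 1 < (k+1)!\<close>, except that for \<open>k \<ge> 3\<close> the second
  entry of the block keeps the value of the preceding block. The ratio of the second entry to the first one is
  then \<open>k\<close>, so the weight is not essentially decreasing.

  For a decreasing weight, \<open>C\<^sub>\<phi>\<close> is a contraction by Littlewood's subordination principle, whose
  partial-sum form can be summed by parts. In the exceptional rows \<open>n + 1\<close> of the matrix of \<open>C\<^sub>\<phi>\<close>,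
  the columns \<open>j < n\<close> are controlled by the fast decay of \<open>1/k!\<close>, the diagonal entry is at most 1,
  and the only dangerous entry is the coefficient of \<open>z\<^bsup>n+1\<^esup>\<close> in \<open>\<phi>\<^sup>n\<close>. It equals
  \<open>n a\<^bsup>n-1\<^esup> b\<close> with \<open>\<phi>(z) = a z + b z\<^sup>2 + \<dots>\<close> and \<open>|a|\<^sup>2 + |b|\<^sup>2 \<le> 1\<close>, hence decays exponentially
  or vanishes, and compensates the ratio \<open>k \<le> n + 1\<close>.
\<close>

unbundle no vec_syntax

subsection \<open>Multiplication by a bounded holomorphic function\<close>

text \<open>Contractivity of multiplication by \<open>G\<close> on square-summable sequences, stated
  through truncations. As \<open>(G * F) $ m\<close> depends only on the first \<open>m + 1\<close>
  coefficients of \<open>F\<close>, arbitrary formal series are allowed and no convergence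
  enters.\<close>

definition contractive_multiplier :: "complex fps \<Rightarrow> bool" where
  "contractive_multiplier G \<longleftrightarrow>
     (\<forall>F M. (\<Sum>m\<le>M. (norm ((G * F) $ m))\<^sup>2) \<le> (\<Sum>m\<le>M. (norm (F $ m))\<^sup>2))"

lemma contractive_multiplier_bound:
  assumes "contractive_multiplier G"
  shows "(\<Sum>m\<le>M. (norm (G $ m))\<^sup>2) \<le> 1"
proof -
  have "(\<Sum>m\<le>M. (norm ((G * 1) $ m))\<^sup>2) \<le> (\<Sum>m\<le>M. (norm ((1::complex fps) $ m))\<^sup>2)"
    using assms unfolding contractive_multiplier_def by blast
  also have "\<dots> = 1"
    by (simp add: sum.atMost_shift)
  finally show ?thesis by simp
qed

text \<open>Cauchy's formula for the \<open>m\<close>-th derivative on the circle of radius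
  \<open>r\<close>, read as a Fourier coefficient.\<close>

lemma has_integral_circle_coefficient:
  fixes r :: real
  assumes "f holomorphic_on ball 0 1" "0 < r" "r < 1"
  shows "((\<lambda>t. f (r * cis (2 * pi * t)) * cnj (cis (2 * pi * t) ^ m)) has_integral
          fps_expansion f 0 $ m * r ^ m) {0..1}"
proof -
  have "cball 0 r \<subseteq> ball (0::complex) 1" "ball 0 r \<subseteq> ball (0::complex) 1"
    using assms by auto
  then have "((\<lambda>u. f u / (u - 0) ^ Suc m) has_contour_integral
      (2 * pi * \<i>) / fact m * (deriv ^^ m) f 0) (circlepath 0 r)"
    using assms by (intro Cauchy_has_contour_integral_higher_derivative_circlepath)
      (auto intro: holomorphic_on_imp_continuous_on holomorphic_on_subset)
  then have "((\<lambda>t. f (circlepath 0 r t) / circlepath 0 r t ^ Suc m *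
       vector_derivative (circlepath 0 r) (at t)) has_integral
      2 * pi * \<i> * fps_expansion f 0 $ m) {0..1}"
    by (simp add: has_contour_integral fps_expansion_def)
  \<comment> \<open>This factor cancels the constant of Cauchy's formula and turns the kernel
    together with \<open>du\<close> into the conjugate character.\<close>
  then have "((\<lambda>t. of_real r ^ m / (2 * pi * \<i>) * (f (circlepath 0 r t) / circlepath 0 r t ^ Suc m *
       vector_derivative (circlepath 0 r) (at t))) has_integral
      of_real r ^ m / (2 * pi * \<i>) * (2 * pi * \<i> * fps_expansion f 0 $ m)) {0..1}"
    by (rule has_integral_mult_right)
  moreover have "of_real r ^ m / (2 * pi * \<i>) * (f (circlepath 0 r t) / circlepath 0 r t ^ Suc m *
       vector_derivative (circlepath 0 r) (at t)) = f (r * cis (2 * pi * t)) * cnj (cis (2 * pi * t) ^ m)" for t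
  proof -
    define c where "c = cis (2 * pi * t)"
    have "c \<noteq> 0" by (simp add: c_def)
    have cp: "circlepath 0 r t = r * c"
      by (simp add: circlepath c_def cis_conv_exp algebra_simps)
    have vd: "vector_derivative (circlepath 0 r) (at t) = 2 * pi * \<i> * r * c"
      by (simp add: vector_derivative_circlepath c_def cis_conv_exp algebra_simps)
    have cn: "cnj (c ^ m) = 1 / c ^ m"
      by (simp add: c_def cis_cnj power_one_over inverse_eq_divide flip: cis_inverse)
    show ?thesis
      unfolding cp vd c_def[symmetric] cn using \<open>c \<noteq> 0\<close> assms
      by (simp add: field_simps)
  qed
  ultimately show ?thesis by (simp add: mult.commute)
qed

text \<open>The coefficient formula for the monomial \<open>z ^ j\<close> on the circle of radius
  \<open>1/2\<close>; multiplication by \<open>2 ^ j\<close> then removes the radius.\<close>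

lemma has_integral_cis_orthonormal:
  "((\<lambda>t. cis (2 * pi * t) ^ j * cnj (cis (2 * pi * t) ^ m)) has_integral (if j = m then 1 else 0)) {0..1}"
proof -
  have "fps_expansion (\<lambda>z::complex. z ^ j) 0 = fps_X ^ j"
    by (intro fps_expansion_eqI fps_expansion_intros)
  then have *: "((\<lambda>t. (of_real (1/2) * cis (2 * pi * t)) ^ j * cnj (cis (2 * pi * t) ^ m)) has_integral
      (fps_X ^ j) $ m * of_real (1/2) ^ m) {0..1}"
    using has_integral_circle_coefficient[of "\<lambda>z. z ^ j" "1/2" m, OF holomorphic_on_power[OF holomorphic_on_id[unfolded id_def]]]
    by simp
  from has_integral_mult_right[OF *, of "2 ^ j"] show ?thesis
    by (cases "j = m") (simp_all add: power_mult_distrib power_divide mult.assoc)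
qed

lemma trigonometric_parseval:
  "((\<lambda>t. (norm (\<Sum>m\<le>M. c m * cis (2 * pi * t) ^ m))\<^sup>2) has_integral (\<Sum>m\<le>M. (norm (c m))\<^sup>2)) {0..1}"
proof -
  have "((\<lambda>t. \<Sum>m\<le>M. \<Sum>j\<le>M. c m * cnj (c j) * (cis (2 * pi * t) ^ m * cnj (cis (2 * pi * t) ^ j)))
      has_integral (\<Sum>m\<le>M. \<Sum>j\<le>M. c m * cnj (c j) * (if m = j then 1 else 0))) {0..1}"
    by (intro has_integral_sum has_integral_mult_right has_integral_cis_orthonormal) auto
  also have "(\<lambda>t. \<Sum>m\<le>M. \<Sum>j\<le>M. c m * cnj (c j) * (cis (2 * pi * t) ^ m * cnj (cis (2 * pi * t) ^ j)))
      = (\<lambda>t. of_real ((norm (\<Sum>m\<le>M. c m * cis (2 * pi * t) ^ m))\<^sup>2))"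
    unfolding complex_norm_square cnj_sum sum_product by (simp add: algebra_simps)
  also have "(\<Sum>m\<le>M. \<Sum>j\<le>M. c m * cnj (c j) * (if m = j then 1 else 0)) =
      of_real (\<Sum>m\<le>M. (norm (c m))\<^sup>2)"
    unfolding of_real_sum complex_norm_square
    by (simp add: if_distrib[of "\<lambda>x. _ * x"] cong: if_cong)
  finally show ?thesis
    by (auto dest: has_integral_Re)
qed

text \<open>Bessel's inequality: \<open>q\<close> is the Fourier partial sum of \<open>g\<close>,
  and both the integral of \<open>|q|^2\<close> and that of \<open>Re (g * cnj q)\<close> equal
  \<open>L\<close>. Integrating \<open>|g - q|^2\<close>, which is nonnegative, gives the
  claim.\<close>

lemma circle_bessel:
  fixes r :: real
  assumes "f holomorphic_on ball 0 1" "0 < r" "r < 1"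
  shows "(\<Sum>m\<le>M. (norm (fps_expansion f 0 $ m))\<^sup>2 * r ^ (2 * m))
      \<le> integral {0..1} (\<lambda>t. (norm (f (r * cis (2 * pi * t))))\<^sup>2)"
proof -
  define c where "c = (\<lambda>m. fps_expansion f 0 $ m * of_real r ^ m)"
  define e where "e = (\<lambda>t. cis (2 * pi * t))"
  define q where "q = (\<lambda>t. \<Sum>m\<le>M. c m * e t ^ m)"
  define g where "g = (\<lambda>t. f (r * e t))"
  define L where "L = (\<Sum>m\<le>M. (norm (c m))\<^sup>2)"
  have "continuous_on {0..1} g"
    unfolding g_def e_def
    using assms holomorphic_on_imp_continuous_on[OF assms(1)]
    by (rule_tac continuous_on_compose2[of "ball 0 1" f])
      (auto simp: norm_mult intro!: continuous_intros)
  then have g: "((\<lambda>t. (norm (g t))\<^sup>2) has_integral integral {0..1} (\<lambda>t. (norm (g t))\<^sup>2)) {0..1}"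
    by (intro integrable_integral integrable_continuous_real continuous_intros)
  have "((\<lambda>t. \<Sum>m\<le>M. cnj (c m) * (g t * cnj (e t ^ m))) has_integral
      (\<Sum>m\<le>M. cnj (c m) * c m)) {0..1}"
    using has_integral_circle_coefficient[OF assms]
    unfolding c_def e_def g_def
    by (intro has_integral_sum has_integral_mult_right) auto
  also have "(\<lambda>t. \<Sum>m\<le>M. cnj (c m) * (g t * cnj (e t ^ m))) = (\<lambda>t. g t * cnj (q t))"
    by (simp add: q_def sum_distrib_left algebra_simps)
  also have "(\<Sum>m\<le>M. cnj (c m) * c m) = of_real L"
    unfolding L_def of_real_sum complex_norm_square by (simp add: mult.commute)
  finally have "((\<lambda>t. Re (g t * cnj (q t))) has_integral Re (of_real L)) {0..1}"
    by (rule has_integral_Re)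
  then have "((\<lambda>t. Re (g t * cnj (q t))) has_integral L) {0..1}"
    by (simp only: Re_complex_of_real)
  moreover have "((\<lambda>t. (norm (q t))\<^sup>2) has_integral L) {0..1}"
    unfolding q_def e_def L_def by (rule trigonometric_parseval)
  ultimately have int: "((\<lambda>t. (norm (g t))\<^sup>2 - 2 * Re (g t * cnj (q t)) + (norm (q t))\<^sup>2) has_integral
      integral {0..1} (\<lambda>t. (norm (g t))\<^sup>2) - 2 * L + L) {0..1}"
    using g by (intro has_integral_add has_integral_diff has_integral_mult_right)
  have "(norm (g t))\<^sup>2 - 2 * Re (g t * cnj (q t)) + (norm (q t))\<^sup>2 = (norm (g t - q t))\<^sup>2" for t
    by (simp add: cmod_power2 power2_diff algebra_simps)
  then have "0 \<le> integral {0..1} (\<lambda>t. (norm (g t))\<^sup>2) - 2 * L + L"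
    by (intro has_integral_nonneg[OF int]) simp
  moreover have "L = (\<Sum>m\<le>M. (norm (fps_expansion f 0 $ m))\<^sup>2 * r ^ (2 * m))"
    using assms by (simp add: L_def c_def norm_mult norm_power power_mult_distrib power_even_eq)
  ultimately show ?thesis
    by (simp add: g_def e_def)
qed

text \<open>After truncating \<open>F\<close> to a polynomial \<open>p\<close>, Bessel for
  \<open>\<phi> * p\<close>, the pointwise bound \<open>|\<phi> * p| \<le> |p|\<close> and Parseval
  for \<open>p\<close> give the estimate on each circle of radius \<open>r < 1\<close>.\<close>

proposition contractive_multiplier_fps_expansion:
  assumes "\<phi> holomorphic_on ball 0 1" "\<And>z. z \<in> ball 0 1 \<Longrightarrow> norm (\<phi> z) \<le> 1"
  shows "contractive_multiplier (fps_expansion \<phi> 0)"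
  unfolding contractive_multiplier_def
proof (intro allI)
  fix F :: "complex fps" and M
  define G where "G = fps_expansion \<phi> 0"
  define p where "p = (\<lambda>z. \<Sum>m\<le>M. F $ m * z ^ m)"
  define h where "h = (\<lambda>z. \<phi> z * p z)"
  define y where "y = (\<lambda>m. (norm ((G * F) $ m))\<^sup>2)"
  define x where "x = (\<lambda>m. (norm (F $ m))\<^sup>2)"
  have holo: "h holomorphic_on ball 0 1"
    unfolding h_def p_def by (intro holomorphic_intros assms)
  have "p has_fps_expansion (\<Sum>m\<le>M. fps_const (F $ m) * fps_X ^ m)"
    unfolding p_def by (intro fps_expansion_intros)
  also have "(\<Sum>m\<le>M. fps_const (F $ m) * fps_X ^ m) = fps_cutoff (Suc M) F"
    by (auto simp: fps_eq_iff fps_sum_nth if_distrib[of "\<lambda>x. _ * x"] cong: if_cong)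
  finally have "h has_fps_expansion G * fps_cutoff (Suc M) F"
    unfolding h_def G_def using assms(1)
    by (intro fps_expansion_intros has_fps_expansion_fps_expansion[of "ball 0 1"]) auto
  then have h: "fps_expansion h 0 = G * fps_cutoff (Suc M) F"
    by (rule fps_expansion_eqI)
  have *: "(G * fps_cutoff (Suc M) F) $ m = (G * F) $ m" if "m \<le> M" for m
    unfolding fps_mult_nth using that by (intro sum.cong) auto
  have "(\<Sum>m\<le>M. y m * r ^ (2 * m)) \<le> (\<Sum>m\<le>M. x m)" if r: "0 < r" "r < 1" for r
  proof -
    have "(\<Sum>m\<le>M. y m * r ^ (2 * m)) = (\<Sum>m\<le>M. (norm (fps_expansion h 0 $ m))\<^sup>2 * r ^ (2 * m))"
      by (intro sum.cong) (auto simp: h * y_def)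
    also have "\<dots> \<le> integral {0..1} (\<lambda>t. (norm (h (r * cis (2 * pi * t))))\<^sup>2)"
      by (rule circle_bessel[OF holo r])
    also have "\<dots> \<le> (\<Sum>m\<le>M. (norm (F $ m * of_real r ^ m))\<^sup>2)"
    proof (rule has_integral_le)
      have in_ball: "r * cis (2 * pi * t) \<in> ball 0 1" for t
        using r by (simp add: norm_mult)
      have "continuous_on {0..1} (\<lambda>t. h (r * cis (2 * pi * t)))"
        using holomorphic_on_imp_continuous_on[OF holo] in_ball
        by (rule_tac continuous_on_compose2[of "ball 0 1" h])
          (auto intro!: continuous_intros)
      then show "((\<lambda>t. (norm (h (r * cis (2 * pi * t))))\<^sup>2) has_integral
          integral {0..1} (\<lambda>t. (norm (h (r * cis (2 * pi * t))))\<^sup>2)) {0..1}"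
        by (intro integrable_integral integrable_continuous_real continuous_intros)
      show "((\<lambda>t. (norm (p (r * cis (2 * pi * t))))\<^sup>2) has_integral
          (\<Sum>m\<le>M. (norm (F $ m * of_real r ^ m))\<^sup>2)) {0..1}"
        using trigonometric_parseval[of "\<lambda>m. F $ m * of_real r ^ m" M]
        by (simp add: p_def power_mult_distrib mult.assoc)
      show "(norm (h (r * cis (2 * pi * t))))\<^sup>2 \<le> (norm (p (r * cis (2 * pi * t))))\<^sup>2" for t
        using assms(2)[OF in_ball[of t]]
        by (intro power_mono) (auto simp: h_def norm_mult mult_left_le_one_le)
    qed
    also have "\<dots> \<le> (\<Sum>m\<le>M. x m)"
      unfolding x_def using r
      by (intro sum_mono power_mono) (auto simp: norm_mult norm_power power_le_one mult_left_le)
    finally show ?thesis .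
  qed
  \<comment> \<open>The right-hand side is free of \<open>r\<close>, so the factors
    \<open>r ^ (2 * m)\<close> disappear in the limit \<open>r\<close> to 1 of a finite sum.\<close>
  then have ev: "eventually (\<lambda>r. (\<Sum>m\<le>M. y m * r ^ (2 * m)) \<le> (\<Sum>m\<le>M. x m)) (at_left 1)"
    by (intro eventually_at_leftI[of 0]) auto
  have "((\<lambda>r. \<Sum>m\<le>M. y m * r ^ (2 * m)) \<longlongrightarrow> (\<Sum>m\<le>M. y m * 1 ^ (2 * m))) (at_left 1)"
    by (intro tendsto_intros)
  from tendsto_upperbound[OF this ev]
  show "(\<Sum>m\<le>M. (norm ((fps_expansion \<phi> 0 * F) $ m))\<^sup>2) \<le> (\<Sum>m\<le>M. (norm (F $ m))\<^sup>2)"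
    by (simp add: y_def x_def G_def)
qed

subsection \<open>Subordination and weighted estimates\<close>

text \<open>Writing \<open>F = F(0) + X F'\<close> gives
  \<open>F oo G = F(0) + G * (F' oo G)\<close>. Multiplication by \<open>G\<close> is contractive
  and \<open>G\<close> shifts degrees up by at least one, so the claim for \<open>F'\<close> up to
  \<open>M\<close> yields the claim for \<open>F\<close> up to \<open>M + 1\<close>.\<close>

theorem littlewood_subordination_fps:
  assumes "contractive_multiplier G" "G $ 0 = 0"
  shows "(\<Sum>m\<le>M. (norm ((F oo G) $ m))\<^sup>2) \<le> (\<Sum>m\<le>M. (norm (F $ m))\<^sup>2)"
proof (induction M arbitrary: F)
  case 0
  show ?case by simp
next
  case (Suc M)
  define F' where "F' = fps_shift 1 F"
  define H where "H = F' oo G"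
  have F: "F = fps_const (F $ 0) + fps_X * F'"
    by (simp add: fps_eq_iff F'_def)
  have FG: "F oo G = fps_const (F $ 0) + G * H"
    by (subst F) (simp add: fps_compose_add_distrib fps_compose_mult_distrib assms H_def)
  \<comment> \<open>Because \<open>G $ 0 = 0\<close>, the coefficient of \<open>H\<close> at
    \<open>Suc M\<close> is not seen; dropping it is what brings the sum over \<open>H\<close> down
    to \<open>M\<close>.\<close>
  have cut: "(G * H) $ m = (G * fps_cutoff (Suc M) H) $ m" if "m \<le> Suc M" for m
    unfolding fps_mult_nth
  proof (rule sum.cong[OF refl])
    fix i assume "i \<in> {0..m}"
    show "G $ i * H $ (m - i) = G $ i * fps_cutoff (Suc M) H $ (m - i)"
      using that assms(2) by (cases "i = 0") auto
  qed
  have "(\<Sum>m\<le>M. (norm ((G * H) $ Suc m))\<^sup>2) = (\<Sum>m\<le>Suc M. (norm ((G * H) $ m))\<^sup>2)"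
    by (simp add: sum.atMost_Suc_shift assms del: sum.atMost_Suc)
  also have "\<dots> = (\<Sum>m\<le>Suc M. (norm ((G * fps_cutoff (Suc M) H) $ m))\<^sup>2)"
    by (intro sum.cong refl) (simp only: cut atMost_iff)
  also have "\<dots> \<le> (\<Sum>m\<le>Suc M. (norm (fps_cutoff (Suc M) H $ m))\<^sup>2)"
    using assms(1) unfolding contractive_multiplier_def by blast
  also have "\<dots> = (\<Sum>m\<le>M. (norm (H $ m))\<^sup>2)"
    by (auto intro: sum.cong)
  also have "\<dots> \<le> (\<Sum>m\<le>M. (norm (F' $ m))\<^sup>2)"
    unfolding H_def by (rule Suc.IH)
  finally have "(\<Sum>m\<le>M. (norm ((F oo G) $ Suc m))\<^sup>2) \<le> (\<Sum>m\<le>M. (norm (F $ Suc m))\<^sup>2)"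
    by (simp add: FG F'_def)
  then show ?case
    by (simp add: sum.atMost_Suc_shift del: sum.atMost_Suc)
qed

text \<open>Summation by parts: domination of all partial sums survives a decreasing nonnegative
  weight.\<close>

lemma weighted_sum_mono:
  fixes u v \<delta> :: "nat \<Rightarrow> real"
  assumes "antimono \<delta>" "\<And>n. 0 \<le> \<delta> n"
    and "\<And>k. (\<Sum>m\<le>k. u m) \<le> (\<Sum>m\<le>k. v m)"
  shows "(\<Sum>m\<le>M. \<delta> m * u m) \<le> (\<Sum>m\<le>M. \<delta> m * v m)"
proof -
  \<comment> \<open>The boundary term of the summation by parts is kept, since nonnegativity alone
    would not carry the induction.\<close>
  have "\<delta> M * (\<Sum>m\<le>M. v m - u m) \<le> (\<Sum>m\<le>M. \<delta> m * (v m - u m))"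
  proof (induction M)
    case (Suc M)
    have "\<delta> (Suc M) * (\<Sum>m\<le>M. v m - u m) \<le> \<delta> M * (\<Sum>m\<le>M. v m - u m)"
      using assms by (intro mult_right_mono) (auto simp: antimono_def sum_subtractf)
    with Suc show ?case by (simp add: algebra_simps)
  qed simp
  moreover have "0 \<le> \<delta> M * (\<Sum>m\<le>M. v m - u m)"
    using assms by (simp add: sum_subtractf)
  ultimately show ?thesis
    by (simp add: right_diff_distrib sum_subtractf)
qed

section \<open>Coefficients of powers near the diagonal\<close>

lemma fps_nth_power_Suc_0:
  fixes H :: "'a::comm_semiring_1 fps"
  shows "(H ^ n) $ Suc 0 = of_nat n * (H $ 0) ^ (n - 1) * H $ Suc 0"
proof (induction n)
  case (Suc n)
  then show ?case
    by (cases n) (simp_all add: fps_mult_nth_1[unfolded One_nat_def] fps_nth_power_0 algebra_simps)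
qed simp

text \<open>With \<open>G = X H\<close>, these are the coefficients of \<open>H ^ n\<close> at 0 and
  1.\<close>

lemma fps_nth_power_diagonals:
  fixes G :: "'a::comm_ring_1 fps"
  assumes "G $ 0 = 0"
  shows "(G ^ n) $ n = (G $ 1) ^ n"
    and "(G ^ n) $ Suc n = of_nat n * (G $ 1) ^ (n - 1) * G $ 2"
proof -
  define H where "H = fps_shift 1 G"
  have G: "G = fps_X * H"
    using assms by (simp add: fps_eq_iff H_def)
  have *: "(G ^ n) $ (n + k) = (H ^ n) $ k" for k
    unfolding G power_mult_distrib by (simp add: fps_X_power_mult_nth)
  show "(G ^ n) $ n = (G $ 1) ^ n"
    using *[of 0] by (simp add: fps_nth_power_0 H_def)
  show "(G ^ n) $ Suc n = of_nat n * (G $ 1) ^ (n - 1) * G $ 2"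
    using *[of 1] by (simp add: fps_nth_power_Suc_0 H_def numeral_2_eq_2)
qed

text \<open>Since \<open>a^2 + b^2 \<le> 1\<close>, either \<open>a < 1\<close> and
  \<open>a ^ (n - 1)\<close> beats every power of \<open>n\<close>, or \<open>b = 0\<close> and the
  entries vanish.\<close>

lemma subdiagonal_bounded:
  assumes "contractive_multiplier G" "G $ 0 = 0"
  obtains K where "\<And>n. real (Suc n) * (norm ((G ^ n) $ Suc n))\<^sup>2 \<le> K"
proof -
  define a where "a = norm (G $ 1)"
  define b where "b = norm (G $ 2)"
  have ab: "a\<^sup>2 + b\<^sup>2 \<le> 1"
    using contractive_multiplier_bound[OF assms(1), of 2] assms(2)
    by (simp add: a_def b_def numeral_2_eq_2)
  have [simp]: "0 \<le> a" "0 \<le> b" by (simp_all add: a_def b_def)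
  have eq: "real (Suc n) * (norm ((G ^ n) $ Suc n))\<^sup>2 = real (Suc n) * (real n * a ^ (n - 1) * b)\<^sup>2" for n
    by (simp only: fps_nth_power_diagonals[OF assms(2)] norm_mult norm_power norm_of_nat a_def b_def)
  consider "a = 0" | "b = 0" | "0 < a" "a < 1"
  proof -
    have "b = 0" if "\<not> a < 1"
    proof -
      have "1 \<le> a\<^sup>2" using that by simp
      with ab have "b\<^sup>2 \<le> 0" by linarith
      then show ?thesis by simp
    qed
    moreover have "0 < a" if "a \<noteq> 0" using that \<open>0 \<le> a\<close> by linarith
    ultimately show thesis using that by blast
  qed
  then have "Bseq (\<lambda>n. real (Suc n) * (real n * a ^ (n - 1) * b)\<^sup>2)"
  proof cases
    case 1
    \<comment> \<open>At \<open>n = 1\<close> the factor \<open>a ^ (n - 1)\<close> is 1 even for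
      \<open>a = 0\<close>, so vanishing starts at \<open>n = 2\<close>.\<close>
    have "eventually (\<lambda>n. real (Suc n) * (real n * a ^ (n - 1) * b)\<^sup>2 = 0) sequentially"
      using eventually_gt_at_top[of 1] by eventually_elim (simp add: 1)
    then show ?thesis
      by (intro convergent_imp_Bseq convergentI tendsto_eventually)
  next
    case 2
    then show ?thesis by simp
  next
    case 3
    then have "(\<lambda>n. real (Suc n) * (real n * a ^ n)\<^sup>2) \<longlonglongrightarrow> 0"
      by real_asymp
    \<comment> \<open>Rescaling by \<open>b / a\<close> replaces \<open>a ^ n\<close> by
      \<open>a ^ (n - 1) * b\<close>; at \<open>n = 0\<close> both sides are 0.\<close>
    then have "(\<lambda>n. (b / a)\<^sup>2 * (real (Suc n) * (real n * a ^ n)\<^sup>2)) \<longlonglongrightarrow> 0"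
      by (rule tendsto_mult_right_zero)
    also have "(\<lambda>n. (b / a)\<^sup>2 * (real (Suc n) * (real n * a ^ n)\<^sup>2)) =
        (\<lambda>n. real (Suc n) * (real n * a ^ (n - 1) * b)\<^sup>2)"
    proof
      fix n
      show "(b / a)\<^sup>2 * (real (Suc n) * (real n * a ^ n)\<^sup>2) = real (Suc n) * (real n * a ^ (n - 1) * b)\<^sup>2"
        using 3 by (cases n) (simp_all add: power_mult_distrib power_divide)
    qed
    finally have "(\<lambda>n. real (Suc n) * (real n * a ^ (n - 1) * b)\<^sup>2) \<longlonglongrightarrow> 0" .
    then show ?thesis
      by (intro convergent_imp_Bseq convergentI)
  qed
  then obtain K where K: "\<And>n. norm (real (Suc n) * (real n * a ^ (n - 1) * b)\<^sup>2) \<le> K"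
    unfolding Bseq_def by blast
  show thesis
  proof (rule that)
    show "real (Suc n) * (norm ((G ^ n) $ Suc n))\<^sup>2 \<le> K" for n
      unfolding eq using K[of n] by (simp only: real_norm_def abs_le_iff)
  qed
qed

lemma norm_add3_squared_le:
  fixes x y z :: "'a::real_normed_vector"
  shows "(norm (x + y + z))\<^sup>2 \<le> 3 * ((norm x)\<^sup>2 + (norm y)\<^sup>2 + (norm z)\<^sup>2)"
proof -
  have "(norm (x + y + z))\<^sup>2 \<le> (norm x + norm y + norm z)\<^sup>2"
    by (intro power_mono order_trans[OF norm_triangle_ineq] add_right_mono norm_triangle_ineq) simp
  also have "\<dots> \<le> 3 * ((norm x)\<^sup>2 + (norm y)\<^sup>2 + (norm z)\<^sup>2)"
    using zero_le_power2[of "norm x - norm y"] zero_le_power2[of "norm x - norm z"]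
      zero_le_power2[of "norm y - norm z"]
    unfolding power2_sum power2_diff by (simp add: algebra_simps)
  finally show ?thesis .
qed

text \<open>Only the columns up to \<open>Suc n\<close> contribute. Those below \<open>n\<close> are
  handled by subordination for the truncation \<open>P\<close>, and the diagonal entry by
  \<open>|G $ 1| \<le> 1\<close>; the subdiagonal entry stays explicit for a later bound.\<close>

lemma compose_nth_Suc_bound:
  assumes "contractive_multiplier G" "G $ 0 = 0"
  shows "(norm ((F oo G) $ Suc n))\<^sup>2 \<le> 3 * ((\<Sum>j<n. (norm (F $ j))\<^sup>2)
    + (norm ((G ^ n) $ Suc n))\<^sup>2 * (norm (F $ n))\<^sup>2 + (norm (F $ Suc n))\<^sup>2)"
proof -
  define P where "P = fps_cutoff n F"
  have "(F oo G) $ Suc n = (\<Sum>i<n. F $ i * (G ^ i) $ Suc n) + F $ n * (G ^ n) $ Suc n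
      + F $ Suc n * (G ^ Suc n) $ Suc n"
  proof -
    have "{0..Suc n} = insert (Suc n) (insert n {..<n})" by auto
    then show ?thesis
      by (simp add: fps_compose_nth add_ac del: power_Suc)
  qed
  also have "(\<Sum>i<n. F $ i * (G ^ i) $ Suc n) = (P oo G) $ Suc n"
    unfolding fps_compose_nth P_def
    by (rule sum.mono_neutral_cong_left) auto
  finally have decomp: "(F oo G) $ Suc n = (P oo G) $ Suc n + F $ n * (G ^ n) $ Suc n
      + F $ Suc n * (G ^ Suc n) $ Suc n" .
  have "(norm ((F oo G) $ Suc n))\<^sup>2 \<le> 3 * ((norm ((P oo G) $ Suc n))\<^sup>2
      + (norm (F $ n * (G ^ n) $ Suc n))\<^sup>2 + (norm (F $ Suc n * (G ^ Suc n) $ Suc n))\<^sup>2)"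
    unfolding decomp by (rule norm_add3_squared_le)
  also have "\<dots> \<le> 3 * ((\<Sum>j<n. (norm (F $ j))\<^sup>2)
    + (norm ((G ^ n) $ Suc n))\<^sup>2 * (norm (F $ n))\<^sup>2 + (norm (F $ Suc n))\<^sup>2)"
  proof (intro mult_left_mono add_mono)
    show "(norm (F $ n * (G ^ n) $ Suc n))\<^sup>2 \<le> (norm ((G ^ n) $ Suc n))\<^sup>2 * (norm (F $ n))\<^sup>2"
      by (simp only: norm_mult power_mult_distrib mult.commute)
    show "(norm ((P oo G) $ Suc n))\<^sup>2 \<le> (\<Sum>j<n. (norm (F $ j))\<^sup>2)"
  proof -
    have "(norm ((P oo G) $ Suc n))\<^sup>2 \<le> (\<Sum>m\<le>Suc n. (norm ((P oo G) $ m))\<^sup>2)"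
      by (rule member_le_sum) auto
    also have "\<dots> \<le> (\<Sum>m\<le>Suc n. (norm (P $ m))\<^sup>2)"
      by (rule littlewood_subordination_fps[OF assms])
    also have "\<dots> = (\<Sum>j<n. (norm (F $ j))\<^sup>2)"
      by (rule sum.mono_neutral_cong_right) (auto simp: P_def)
    finally show ?thesis .
  qed
    show "(norm (F $ Suc n * (G ^ Suc n) $ Suc n))\<^sup>2 \<le> (norm (F $ Suc n))\<^sup>2"
  proof -
    have "(norm (G $ 1))\<^sup>2 \<le> 1"
      using contractive_multiplier_bound[OF assms(1), of 1] assms(2) by simp
    then have "norm (G $ 1) \<le> 1"
      by (simp add: abs_square_le_1)
    then have "norm ((G ^ Suc n) $ Suc n) \<le> 1"
      by (simp only: fps_nth_power_diagonals[OF assms(2)] norm_power) (simp add: power_le_one del: power_Suc)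
    then have "norm (F $ Suc n * (G ^ Suc n) $ Suc n) \<le> norm (F $ Suc n)"
      unfolding norm_mult by (intro mult_left_le) auto
    then show ?thesis by (intro power_mono) auto
  qed
  qed simp
  finally show ?thesis .
qed

text \<open>Controls the columns \<open>j < n\<close> of all exceptional rows together;
  \<open>\<delta> (n - 1)\<close> is the weight of the exceptional row \<open>Suc n\<close>.\<close>

lemma halving_weights_sum_le:
  fixes \<delta> x :: "nat \<Rightarrow> real"
  assumes "antimono \<delta>" "\<And>n. 0 \<le> \<delta> n" "\<And>n. 0 \<le> x n"
    and "\<And>n. n \<in> S \<Longrightarrow> 2 * \<delta> n \<le> \<delta> (n - 1)"
  shows "(\<Sum>n<M. (if n \<in> S then \<delta> (n - 1) else 0) * (\<Sum>j<n. x j)) \<le> 2 * (\<Sum>j<M. \<delta> j * x j)"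
proof -
  \<comment> \<open>The subtracted boundary term makes the induction close.\<close>
  have "(\<Sum>n<M. (if n \<in> S then \<delta> (n - 1) else 0) * (\<Sum>j<n. x j))
      \<le> 2 * (\<Sum>j<M. \<delta> j * x j) - 2 * \<delta> (M - 1) * (\<Sum>j<M. x j)"
  proof (induction M)
    case (Suc M)
    have "(if M \<in> S then \<delta> (M - 1) else 0) \<le> 2 * (\<delta> (M - 1) - \<delta> M)"
      \<comment> \<open>halving bounds the weight by its own drop, so the sum telescopes\<close>
      using assms(4)[of M] antimonoD[OF assms(1), of "M - 1" M] by auto
    then have "(if M \<in> S then \<delta> (M - 1) else 0) * (\<Sum>j<M. x j)
        \<le> 2 * (\<delta> (M - 1) - \<delta> M) * (\<Sum>j<M. x j)"
      using assms(3) by (intro mult_right_mono sum_nonneg)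
    with Suc show ?case by (simp add: algebra_simps)
  qed simp
  moreover have "0 \<le> 2 * \<delta> (M - 1) * (\<Sum>j<M. x j)"
    using assms by (intro mult_nonneg_nonneg sum_nonneg) auto
  ultimately show ?thesis by linarith
qed

text \<open>Here \<open>\<delta>\<close> is the decreasing weight and \<open>S\<close> marks its
  drops. Subordination with weight \<open>\<delta>\<close> covers all rows; the excess in the rows
  \<open>Suc n\<close> with \<open>n\<close> in \<open>S\<close> is charged to the columns below
  \<open>n\<close>, at \<open>n\<close> and at \<open>Suc n\<close>.\<close>

proposition composition_bounded_fps:
  fixes \<delta> \<beta> :: "nat \<Rightarrow> real"
  assumes "contractive_multiplier G" "G $ 0 = 0"
    and "antimono \<delta>" "\<And>n. 0 \<le> \<delta> n" "\<And>n. \<delta> n \<le> \<beta> n"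
    and other: "\<And>m. m \<notin> Suc ` S \<Longrightarrow> \<beta> m = \<delta> m"
    and bad: "\<And>n. n \<in> S \<Longrightarrow> \<beta> (Suc n) = \<delta> (n - 1)"
    and halve: "\<And>n. n \<in> S \<Longrightarrow> 2 * \<delta> n \<le> \<delta> (n - 1)"
    and ratio: "\<And>n. n \<in> S \<Longrightarrow> \<delta> (n - 1) \<le> real (Suc n) * \<delta> n"
  obtains C where "C \<ge> 0"
    "\<And>F M. (\<Sum>m\<le>M. (norm ((F oo G) $ m))\<^sup>2 * \<beta> m) \<le> C * (\<Sum>m\<le>M. (norm (F $ m))\<^sup>2 * \<beta> m)"
proof -
  obtain K where K: "\<And>n. real (Suc n) * (norm ((G ^ n) $ Suc n))\<^sup>2 \<le> K"
    using subdiagonal_bounded[OF assms(1,2)] by blast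
  have K0: "0 \<le> K" using K[of 0] by simp
  have \<beta>0: "0 \<le> \<beta> n" for n using assms(4,5) order_trans by blast
  \<comment> \<open>The 10 is 1 from subordination, 6 from the columns below \<open>n\<close> and 3
    from the diagonal; \<open>3 * K\<close> comes from the subdiagonal.\<close>
  have "(\<Sum>m\<le>M. (norm ((F oo G) $ m))\<^sup>2 * \<beta> m) \<le> (10 + 3 * K) * (\<Sum>m\<le>M. (norm (F $ m))\<^sup>2 * \<beta> m)" for F M
  proof -
    define x where "x = (\<lambda>m. (norm (F $ m))\<^sup>2)"
    define y where "y = (\<lambda>m. (norm ((F oo G) $ m))\<^sup>2)"
    define s where "s = (\<lambda>n. if n \<in> S then \<delta> (n - 1) else 0)"
    have x0: "0 \<le> x m" and y0: "0 \<le> y m" for m by (simp_all add: x_def y_def)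
    have row: "\<beta> (Suc n) * y (Suc n) \<le> \<delta> (Suc n) * y (Suc n) + 3 * (s n * (\<Sum>j<n. x j))
        + 3 * K * (\<beta> n * x n) + 3 * (\<beta> (Suc n) * x (Suc n))" for n
    proof (cases "n \<in> S")
      case False
      then have "\<beta> (Suc n) = \<delta> (Suc n)" by (intro other) auto
      then show ?thesis using False K0 \<beta>0 x0 assms(4) by (simp add: s_def)
    next
      case True
      have "\<beta> (Suc n) * y (Suc n) \<le> \<beta> (Suc n) *
          (3 * ((\<Sum>j<n. x j) + (norm ((G ^ n) $ Suc n))\<^sup>2 * x n + x (Suc n)))"
        unfolding x_def y_def by (intro mult_left_mono compose_nth_Suc_bound assms(1,2) \<beta>0)
      also have "\<dots> = 3 * (s n * (\<Sum>j<n. x j)) + 3 * (\<beta> (Suc n) * (norm ((G ^ n) $ Suc n))\<^sup>2 * x n)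
          + 3 * (\<beta> (Suc n) * x (Suc n))"
        using True by (simp add: s_def bad algebra_simps)
      finally have 1: "\<beta> (Suc n) * y (Suc n) \<le> \<dots>" .
      \<comment> \<open>Moving the weight from row \<open>Suc n\<close> to column \<open>n\<close>
        costs a factor \<open>Suc n\<close>, exactly the one built into the bound
        \<open>K\<close>.\<close>
      have "\<beta> (Suc n) \<le> real (Suc n) * \<beta> n"
        using ratio[OF True] bad[OF True] assms(5)[of n]
        by (smt (verit) mult_left_mono of_nat_0_le_iff)
      then have "\<beta> (Suc n) * (norm ((G ^ n) $ Suc n))\<^sup>2 \<le> real (Suc n) * \<beta> n * (norm ((G ^ n) $ Suc n))\<^sup>2"
        by (intro mult_right_mono) auto
      also have "\<dots> = \<beta> n * (real (Suc n) * (norm ((G ^ n) $ Suc n))\<^sup>2)" by (simp only: ac_simps)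
      also have "\<dots> \<le> \<beta> n * K" by (intro mult_left_mono K \<beta>0)
      finally have "\<beta> (Suc n) * (norm ((G ^ n) $ Suc n))\<^sup>2 * x n \<le> \<beta> n * K * x n"
        using x0 by (intro mult_right_mono)
      moreover have "0 \<le> \<delta> (Suc n) * y (Suc n)" using assms(4) y0 by simp
      moreover have "\<beta> n * K * x n = K * (\<beta> n * x n)" by simp
      ultimately show ?thesis using 1 by linarith
    qed
    have "0 \<notin> Suc ` S" by auto
    then have "(\<Sum>m\<le>M. \<beta> m * y m) = \<delta> 0 * y 0 + (\<Sum>n<M. \<beta> (Suc n) * y (Suc n))"
      by (simp add: sum.atMost_shift other)
    also have "\<dots> \<le> \<delta> 0 * y 0 + (\<Sum>n<M. \<delta> (Suc n) * y (Suc n) + 3 * (s n * (\<Sum>j<n. x j))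
        + 3 * K * (\<beta> n * x n) + 3 * (\<beta> (Suc n) * x (Suc n)))"
      by (intro add_left_mono sum_mono row)
    also have "\<dots> = (\<Sum>m\<le>M. \<delta> m * y m) + 3 * (\<Sum>n<M. s n * (\<Sum>j<n. x j))
        + 3 * K * (\<Sum>n<M. \<beta> n * x n) + 3 * (\<Sum>n<M. \<beta> (Suc n) * x (Suc n))"
      by (simp add: sum.atMost_shift sum.distrib sum_distrib_left)
    also have "\<dots> \<le> (\<Sum>m\<le>M. \<beta> m * x m) + 3 * (2 * (\<Sum>m\<le>M. \<beta> m * x m))
        + 3 * K * (\<Sum>m\<le>M. \<beta> m * x m) + 3 * (\<Sum>m\<le>M. \<beta> m * x m)"
    proof (intro add_mono mult_left_mono)
      have "(\<Sum>m\<le>M. \<delta> m * y m) \<le> (\<Sum>m\<le>M. \<delta> m * x m)"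
        unfolding x_def y_def
        by (intro weighted_sum_mono littlewood_subordination_fps assms)
      also have "\<dots> \<le> (\<Sum>m\<le>M. \<beta> m * x m)"
        by (intro sum_mono mult_right_mono assms x0)
      finally show "(\<Sum>m\<le>M. \<delta> m * y m) \<le> (\<Sum>m\<le>M. \<beta> m * x m)" .
      have "(\<Sum>n<M. s n * (\<Sum>j<n. x j)) \<le> 2 * (\<Sum>j<M. \<delta> j * x j)"
        unfolding s_def by (intro halving_weights_sum_le assms x0)
      also have "(\<Sum>j<M. \<delta> j * x j) \<le> (\<Sum>j<M. \<beta> j * x j)"
        by (intro sum_mono mult_right_mono assms x0)
      also have le: "\<dots> \<le> (\<Sum>m\<le>M. \<beta> m * x m)"
        by (intro sum_mono2) (auto simp: \<beta>0 x0)
      finally show "(\<Sum>n<M. s n * (\<Sum>j<n. x j)) \<le> 2 * (\<Sum>m\<le>M. \<beta> m * x m)" by simp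
      show "(\<Sum>j<M. \<beta> j * x j) \<le> (\<Sum>m\<le>M. \<beta> m * x m)" by (fact le)
      show "(\<Sum>n<M. \<beta> (Suc n) * x (Suc n)) \<le> (\<Sum>m\<le>M. \<beta> m * x m)"
        using \<beta>0 x0 by (simp add: sum.atMost_shift)
    qed (use K0 in auto)
    also have "\<dots> = (10 + 3 * K) * (\<Sum>m\<le>M. \<beta> m * x m)" by (simp add: algebra_simps)
    finally show ?thesis by (simp add: x_def y_def mult.commute)
  qed
  then show thesis using K0 by (intro that[of "10 + 3 * K"]) auto
qed

text \<open>Passes from truncations to functions by letting \<open>M\<close> grow. The hypothesis
  bounds squared norms, so the operator bound is \<open>sqrt C\<close>.\<close>

lemma bounded_composition_if_fps_bound:
  assumes "\<phi> holomorphic_on ball 0 1" "\<phi> ` ball 0 1 \<subseteq> ball 0 1" "\<phi> 0 = 0"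
    and "C \<ge> 0" "\<And>n. 0 \<le> \<beta> n"
    and bound: "\<And>F M. (\<Sum>m\<le>M. (norm ((F oo fps_expansion \<phi> 0) $ m))\<^sup>2 * \<beta> m)
      \<le> C * (\<Sum>m\<le>M. (norm (F $ m))\<^sup>2 * \<beta> m)"
  shows "bounded_composition \<beta> \<phi>"
  unfolding bounded_composition_def
proof (intro exI[of _ "sqrt C"] allI impI)
  fix f assume "in_H2 \<beta> f"
  then have f: "f holomorphic_on ball 0 1" and sum_f: "summable (\<lambda>n. (norm (taylor_coeff f n))\<^sup>2 * \<beta> n)"
    by (auto simp: in_H2_def)
  define F where "F = fps_expansion f 0"
  define G where "G = fps_expansion \<phi> 0"
  have coeff: "taylor_coeff g n = fps_expansion g 0 $ n" for g n
    by (simp add: taylor_coeff_def fps_expansion_def)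
  have "f has_fps_expansion F" "\<phi> has_fps_expansion G"
    unfolding F_def G_def using f assms(1)
    by (auto intro: has_fps_expansion_fps_expansion[of "ball 0 1"])
  moreover have "G $ 0 = 0"
    using assms(3) by (simp add: G_def fps_expansion_def)
  ultimately have FG: "fps_expansion (f \<circ> \<phi>) 0 = F oo G"
    by (intro fps_expansion_eqI has_fps_expansion_compose)
  define T where "T = (\<Sum>n. (norm (F $ n))\<^sup>2 * \<beta> n)"
  have "(\<Sum>m<M. (norm ((F oo G) $ m))\<^sup>2 * \<beta> m) \<le> C * T" for M
  proof -
    have "(\<Sum>m<M. (norm ((F oo G) $ m))\<^sup>2 * \<beta> m) \<le> (\<Sum>m\<le>M. (norm ((F oo G) $ m))\<^sup>2 * \<beta> m)"
      using assms(5) by (intro sum_mono2) auto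
    also have "\<dots> \<le> C * (\<Sum>m\<le>M. (norm (F $ m))\<^sup>2 * \<beta> m)"
      unfolding G_def by (rule bound)
    also have "\<dots> \<le> C * T"
      unfolding T_def using sum_f assms(4,5)
      by (intro mult_left_mono sum_le_suminf) (auto simp: coeff F_def)
    finally show ?thesis .
  qed
  then have sum_FG: "summable (\<lambda>m. (norm ((F oo G) $ m))\<^sup>2 * \<beta> m)"
    and le: "(\<Sum>m. (norm ((F oo G) $ m))\<^sup>2 * \<beta> m) \<le> C * T"
    using assms(5) by (auto intro!: summableI_nonneg_bounded suminf_le_const)
  show "in_H2 \<beta> (f \<circ> \<phi>) \<and> H2_norm \<beta> (f \<circ> \<phi>) \<le> sqrt C * H2_norm \<beta> f"
    using holomorphic_on_compose_gen[OF assms(1) f assms(2)] sum_FG real_sqrt_le_mono[OF le]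
    by (simp add: in_H2_def H2_norm_def coeff FG T_def real_sqrt_mult flip: F_def)
qed

subsection \<open>The weight\<close>

text \<open>The number of the block containing \<open>n\<close>. As \<open>0! = 1!\<close>, the
  greatest choice resolves the tie in favour of 1.\<close>

definition fact_index :: "nat \<Rightarrow> nat" where
  "fact_index n = (GREATEST k. fact k \<le> Suc n)"

lemma fact_index:
  shows "fact (fact_index n) \<le> Suc n" and fact_index_ge: "fact k \<le> Suc n \<Longrightarrow> k \<le> fact_index n"
proof -
  have le: "k \<le> Suc n" if "fact k \<le> Suc n" for k :: nat
    using that fact_ge_self[of k] by linarith
  show "fact (fact_index n) \<le> Suc n"
    unfolding fact_index_def by (rule GreatestI_nat[where P = "\<lambda>k. fact k \<le> Suc n" and k = 0 and b = "Suc n"]) (use le in auto)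
  show "k \<le> fact_index n" if "fact k \<le> Suc n"
    unfolding fact_index_def by (rule Greatest_le_nat[where P = "\<lambda>k. fact k \<le> Suc n" and b = "Suc n"]) (use le that in auto)
qed

lemma fact_index_eqI:
  assumes "fact k \<le> Suc n" "Suc n < fact (Suc k)"
  shows "fact_index n = k"
proof (rule antisym)
  show "fact_index n \<le> k"
  proof (rule ccontr)
    assume "\<not> fact_index n \<le> k"
    then have "fact (Suc k) \<le> (fact (fact_index n) :: nat)"
      by (intro fact_mono) auto
    with fact_index(1)[of n] assms(2) show False by linarith
  qed
qed (rule fact_index_ge[OF assms(1)])

lemma mono_fact_index: "mono fact_index"
  by (intro monoI fact_index_ge) (use fact_index(1) in \<open>auto intro: order_trans\<close>)

definition step_weight :: "nat \<Rightarrow> real" where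
  "step_weight n = 1 / fact (fact_index n)"

definition jumps :: "nat set" where
  "jumps = {fact k - 1 | k. 3 \<le> k}"

text \<open>For \<open>n = Suc m\<close> with \<open>m\<close> in \<open>jumps\<close>, the index
  \<open>n - 2 = m - 1\<close> is the last one of the preceding block.\<close>

definition bump_weight :: "nat \<Rightarrow> real" where
  "bump_weight n = (if n \<in> Suc ` jumps then step_weight (n - 2) else step_weight n)"

lemma step_weight_pos: "0 < step_weight n" and step_weight_le_1: "step_weight n \<le> 1"
  by (simp_all add: step_weight_def)

lemma antimono_step_weight: "antimono step_weight"
  unfolding step_weight_def
  by (intro antimonoI frac_le) (auto intro!: fact_mono monoD[OF mono_fact_index])

lemma step_weight_le_bump_weight: "step_weight n \<le> bump_weight n"
  by (simp add: bump_weight_def antimonoD[OF antimono_step_weight])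

text \<open>Blocks are measured by \<open>n + 1\<close>, so \<open>fact k - 1\<close> opens block
  \<open>k\<close> and \<open>fact k - 2\<close> closes block \<open>k - 1\<close>.\<close>

lemma step_weight_at_jump:
  assumes "3 \<le> k"
  shows "step_weight (fact k - 1) = 1 / fact k"
    and "step_weight (fact k - 2) = 1 / fact (k - 1)"
    and "step_weight (fact k - 2) = real k * step_weight (fact k - 1)"
proof -
  have k: "fact k = k * fact (k - 1)"
    using assms by (simp add: fact_reduce)
  have "fact (k - 1) \<ge> (1::nat)" "fact k \<ge> k"
    by (auto simp: fact_ge_self)
  have "3 * fact (k - 1) \<le> (fact k :: nat)"
    unfolding k using assms by simp
  then have k1: "fact (k - 1) \<le> (fact k :: nat) - 1"
    using \<open>fact (k - 1) \<ge> (1::nat)\<close> by linarith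
  have "fact_index (fact k - 1) = k"
    using assms by (intro fact_index_eqI) simp_all
  then show 1: "step_weight (fact k - 1) = 1 / fact k"
    by (simp add: step_weight_def)
  have "Suc (fact k - 2) = fact k - 1"
    using \<open>fact k \<ge> k\<close> assms by linarith
  then have "fact_index (fact k - 2) = k - 1"
    using k1 assms by (intro fact_index_eqI) simp_all
  then show 2: "step_weight (fact k - 2) = 1 / fact (k - 1)"
    by (simp add: step_weight_def)
  show "step_weight (fact k - 2) = real k * step_weight (fact k - 1)"
    unfolding 1 2 using assms by (simp add: fact_reduce[of k])
qed

text \<open>The ratio is \<open>k\<close>, and \<open>2 \<le> k \<le> k! = n + 1\<close>.\<close>

lemma step_weight_jump_ratio:
  assumes "n \<in> jumps"
  shows "2 * step_weight n \<le> step_weight (n - 1)"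
    and "step_weight (n - 1) \<le> real (Suc n) * step_weight n"
proof -
  obtain k where k: "3 \<le> k" "n = fact k - 1"
    using assms by (auto simp: jumps_def)
  have "n - 1 = fact k - 2" using k by simp
  then have *: "step_weight (n - 1) = real k * step_weight n"
    using step_weight_at_jump[OF k(1)] k by simp
  show "2 * step_weight n \<le> step_weight (n - 1)"
    unfolding * using k step_weight_pos[of n] by (intro mult_right_mono) auto
  have "k \<le> Suc n"
    using k fact_ge_self[of k] by simp
  then show "step_weight (n - 1) \<le> real (Suc n) * step_weight n"
    unfolding * using step_weight_pos[of n] by (intro mult_right_mono) auto
qed

lemma bump_weight_Suc_jump: "n \<in> jumps \<Longrightarrow> bump_weight (Suc n) = step_weight (n - 1)"
  by (simp add: bump_weight_def)

section \<open>Minoration and growth properties of the weight\<close>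

lemma bump_weight_polynomial_minoration: "polynomial_minoration bump_weight"
  unfolding polynomial_minoration_def
proof (intro exI conjI allI impI)
  fix n :: nat assume n: "1 \<le> n"
  have "fact (fact_index n) \<le> real (Suc n)"
    using fact_index(1)[of n] by (metis of_nat_fact of_nat_le_iff)
  \<comment> \<open>From \<open>n + 1 \<le> 2 * n\<close> come the constant \<open>1/2\<close> and
    the exponent 1.\<close>
  then have "fact (fact_index n) \<le> 2 * real n"
    using n by simp
  then have "1 / (2 * real n) \<le> step_weight n"
    unfolding step_weight_def by (intro frac_le) auto
  also note step_weight_le_bump_weight
  finally show "1 / 2 * real n powr - 1 \<le> bump_weight n"
    using n by (simp add: powr_minus_divide)
qed auto

text \<open>From \<open>n = k! - 1\<close> to \<open>n + 1\<close> the weight grows by the factor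
  \<open>k\<close>, which exceeds any given \<open>C\<close>.\<close>

lemma bump_weight_not_essentially_decreasing: "\<not> essentially_decreasing bump_weight"
proof
  assume "essentially_decreasing bump_weight"
  then obtain C where C: "\<And>m n. n \<le> m \<Longrightarrow> bump_weight m \<le> C * bump_weight n"
    unfolding essentially_decreasing_def by blast
  obtain k where k: "3 \<le> k" "C < real k"
    using reals_Archimedean2[of C] by (metis less_le_trans max.cobounded1 max.cobounded2 of_nat_le_iff)
  define n :: nat where "n = fact k - 1"
  have "n \<in> jumps"
    using k by (auto simp: jumps_def n_def)
  \<comment> \<open>The index \<open>n\<close> must not itself be raised: that would require
    \<open>k! = j! + 1\<close>, although both factorials are even.\<close>
  have "n \<notin> Suc ` jumps"
  proof
    assume "n \<in> Suc ` jumps"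
    then obtain j where j: "3 \<le> j" "n = Suc (fact j - 1)"
      by (auto simp: jumps_def)
    then have "fact k = (fact j :: nat) + 1"
      by (simp add: n_def) (metis Suc_pred fact_gt_zero)
    moreover have "even (fact k :: nat)" "even (fact j :: nat)"
      using j k by (auto intro!: dvd_fact)
    ultimately show False by simp
  qed
  then have "bump_weight n = step_weight n"
    by (simp add: bump_weight_def)
  moreover have "bump_weight (Suc n) = real k * step_weight n"
    using step_weight_at_jump[OF k(1)] bump_weight_Suc_jump[OF \<open>n \<in> jumps\<close>]
    by (simp add: n_def numeral_2_eq_2)
  ultimately have "real k * step_weight n \<le> C * step_weight n"
    using C[of n "Suc n"] by simp
  with k(2) step_weight_pos[of n] show False by simp
qed

theorem mainTheorem6:
  shows "\<exists>\<beta> :: nat \<Rightarrow> real. (\<forall>n. \<beta> n > 0) \<and> bounded (range \<beta>) \<and>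
           polynomial_minoration \<beta> \<and> \<not> essentially_decreasing \<beta> \<and>
           (\<forall>\<phi>. symbol \<phi> \<and> \<phi> 0 = 0 \<longrightarrow> bounded_composition \<beta> \<phi>)"
proof (intro exI[of _ bump_weight] conjI allI impI)
  show pos: "0 < bump_weight n" for n
    by (simp add: bump_weight_def step_weight_pos)
  show "bounded (range bump_weight)"
    using pos by (intro boundedI[of _ 1]) (auto simp: bump_weight_def step_weight_le_1 abs_of_pos step_weight_pos)
  fix \<phi> assume "symbol \<phi> \<and> \<phi> 0 = 0"
  then have \<phi>: "\<phi> holomorphic_on ball 0 1" "\<phi> ` ball 0 1 \<subseteq> ball 0 1" "\<phi> 0 = 0"
    by (auto simp: symbol_def)
  have "contractive_multiplier (fps_expansion \<phi> 0)"
  proof (rule contractive_multiplier_fps_expansion[OF \<phi>(1)])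
    show "norm (\<phi> z) \<le> 1" if "z \<in> ball 0 1" for z
      using subsetD[OF \<phi>(2) imageI[OF that]] by simp
  qed
  moreover have "fps_expansion \<phi> 0 $ 0 = 0"
    using \<phi>(3) by (simp add: fps_expansion_def)
  moreover have "bump_weight m = step_weight m" if "m \<notin> Suc ` jumps" for m
    using that by (simp add: bump_weight_def)
  \<comment> \<open>The constant may depend on \<open>\<phi>\<close>, as it does through the
    subdiagonal bound.\<close>
  ultimately obtain C where "C \<ge> 0"
    "\<And>F M. (\<Sum>m\<le>M. (norm ((F oo fps_expansion \<phi> 0) $ m))\<^sup>2 * bump_weight m)
      \<le> C * (\<Sum>m\<le>M. (norm (F $ m))\<^sup>2 * bump_weight m)"
    using composition_bounded_fps[of "fps_expansion \<phi> 0" step_weight bump_weight jumps]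
      antimono_step_weight step_weight_pos[THEN less_imp_le] step_weight_le_bump_weight
      bump_weight_Suc_jump step_weight_jump_ratio
    by blast
  then show "bounded_composition bump_weight \<phi>"
    using \<phi> pos[THEN less_imp_le] by (intro bounded_composition_if_fps_bound)
qed (fact bump_weight_polynomial_minoration bump_weight_not_essentially_decreasing)+

end
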